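(* Let $m\ge 1$ be an odd integer and let $X\in\mathcal{G}_{4m^{2}}(2m^{2}-m)$. If $X_C$ is a circulant Hadamard matrix of order $4m^2$, then $X\in\mathcal{G}_{2m^{2}}(a)\times\mathcal{G}_{2m^{2}}(b)$ for some integers $a,b$ with $$\frac{m^{2}-m}{2}\leq a\leq\frac{3m^{2}-m}{2}\qquad\text{and}\qquad b=2m^{2}-m-a.$$
   Context: $\mathbb{Z}_2=\{+1,-1\}$ is the multiplicative group of order 2, and $\mathbb{Z}_2^n$ is the set of sequences of length $n$ with entries $\pm1$. The Hamming weight $\omega(X)$ of $X\in\mathbb{Z}_2^n$ is the number of entries of $X$ equal to $+1$. For $0\le k\le n$, $\mathcal{G}_n(k)=\{X\in\mathbb{Z}_2^n:\omega(X)=k\}$. The product $\mathcal{G}_{2m^2}(a)\times\mathcal{G}_{2m^2}(b)$ is viewed inside $\mathbb{Z}_2^{4m^2}$ by concatenation: it is the set of sequences $(B,D)$ with $B\in\mathcal{G}_{2m^2}(a)$ (first $2m^2$ entries) and $D\in\mathcal{G}_{2m^2}(b)$ (last $2m^2$ entries). $C$ is the cyclic shift $C(x_0,x_1,\dots,x_{n-1})=(x_1,\dots,x_{n-1},x_0)$, and $X_C=\{C^i(X): 0\le i\le n-1\}$ is the orbit of $X$, identified with the circulant matrix having first row $X$ and whose rows are the cyclic shifts of $X$. A Hadamard matrix of order $n$ is an $n\times n$ matrix $H$ with entries $\pm1$ and $HH^{t}=nI_n$; "$X_C$ is a circulant Hadamard matrix" means that the circulant matrix with first row $X$ is Hadamard.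 *)

theory Defs
  imports Complex_Main "Jordan_Normal_Form.Matrix"
begin

text \<open>Binary sequences are integer lists with entries \<open>1\<close> and \<open>-1\<close>.\<close>

definition pm_seqs :: "nat \<Rightarrow> int list set" where
  "pm_seqs n = {X. length X = n \<and> set X \<subseteq> {1, -1}}"

definition hamming_weight :: "int list \<Rightarrow> nat" where
  "hamming_weight X = count_list X 1"

definition weight_class :: "nat \<Rightarrow> nat \<Rightarrow> int list set" where
  "weight_class n k = {X \<in> pm_seqs n. hamming_weight X = k}"

definition concat_prod :: "'a list set \<Rightarrow> 'a list set \<Rightarrow> 'a list set" where
  "concat_prod A B = {U @ V | U V. U \<in> A \<and> V \<in> B}"

text \<open>
  The cyclic shift \<open>(x\<^sub>0, x\<^sub>1, \<dots>) \<mapsto> (x\<^sub>1, \<dots>, x\<^sub>0)\<close> is \<^const>\<open>rotate1\<close>, with iterates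
  \<^const>\<open>rotate\<close>. Row \<open>i\<close> of the circulant matrix is the \<open>i\<close>-th iterate, so its \<open>(i, j)\<close>
  entry is \<open>X ! ((i + j) mod n)\<close> (left shifts, not the right shifts of another common
  convention).
\<close>

definition circulant :: "'a list \<Rightarrow> 'a mat" where
  "circulant X = mat_of_rows_list (length X) (map (\<lambda>i. rotate i X) [0..<length X])"

definition hadamard_mat :: "nat \<Rightarrow> int mat \<Rightarrow> bool" where
  "hadamard_mat n H \<longleftrightarrow>
     H \<in> carrier_mat n n \<and> elements_mat H \<subseteq> {1, -1} \<and>
     H * transpose_mat H = int n \<cdot>\<^sub>m 1\<^sub>m n"

end

theory Submission
  imports Defs
begin

text \<open>
  Write \<open>n = 2N\<close> for the order and let \<open>d\<^sub>i\<close> be the sum of the first half minus the sum of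
  the second half of the \<open>i\<close>-th cyclic shift of \<open>X\<close>. If the first half of \<open>X\<close> contains \<open>a\<close>
  entries \<open>1\<close> and the second half contains \<open>b\<close>, then \<open>d\<^sub>0 = 2(a - b)\<close>. Since the weight
  fixes \<open>a + b = 2m\<^sup>2 - m\<close>, the required bounds on \<open>a\<close> say exactly that \<open>\<bar>a - b\<bar> \<le> m\<^sup>2\<close>, that is
  \<open>\<bar>d\<^sub>0\<bar> \<le> N\<close> for \<open>N = 2m\<^sup>2\<close>.

  The vector \<open>d\<close> is the image under the Hadamard matrix of the vector with \<open>N\<close> entries \<open>1\<close>
  followed by \<open>N\<close> entries \<open>-1\<close>. A Hadamard matrix multiplies squared lengths by its order, so
  the squares of the \<open>d\<^sub>i\<close> add up to \<open>(2N)\<^sup>2\<close> (\<open>sum_half_diff_squares\<close>). On the other hand \<open>d\<close>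
  cannot have an isolated peak: a shift by \<open>N\<close> exchanges the halves and turns \<open>d\<^sub>i\<close> into \<open>- d\<^sub>i\<close>,
  and a shift by one moves only two entries across, changing \<open>d\<^sub>i\<close> by at most \<open>4\<close>. Thus
  \<open>\<bar>d\<^sub>0\<bar> > N\<close> would force two squares above \<open>N\<^sup>2\<close> and four above \<open>(N - 4)\<^sup>2\<close>, whose sum
  exceeds \<open>4N\<^sup>2\<close> as soon as \<open>N \<ge> 14\<close> (\<open>half_diff_bound\<close>). This covers every odd \<open>m \<ge> 3\<close>. For
  \<open>m = 1\<close> the sequence has a single entry \<open>1\<close>, so \<open>\<bar>a - b\<bar> = 1\<close>.
\<close>

section \<open>Orthogonality of the cyclic shifts\<close>

definition cyc :: "'a list \<Rightarrow> nat \<Rightarrow> 'a" where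
  "cyc X i = X ! (i mod length X)"

lemma cyc_add_two_halves:
  assumes "length X = 2 * N"
  shows "cyc X (i + N + N) = cyc X i"
proof -
  have "i + N + N = i + length X"
    using assms by simp
  then show ?thesis
    by (simp only: cyc_def mod_add_self2)
qed

lemma circulant_carrier: "circulant X \<in> carrier_mat (length X) (length X)"
  by (simp add: circulant_def mat_of_rows_list_def)

lemma circulant_index:
  assumes "i < length X" "j < length X"
  shows "circulant X $$ (i, j) = cyc X (i + j)"
  using assms by (simp add: circulant_def mat_of_rows_list_def nth_rotate cyc_def)

lemma hadamard_circulant_correlation:
  assumes H: "hadamard_mat (length X) (circulant X)"
    and j: "j < length X" and k: "k < length X"
  shows "(\<Sum>i<length X. cyc X (i + j) * cyc X (i + k)) = (if j = k then int (length X) else 0)"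
proof -
  let ?n = "length X" and ?H = "circulant X"
  have c: "?H \<in> carrier_mat ?n ?n"
    by (rule circulant_carrier)
  have "(?H * transpose_mat ?H) $$ (j, k) = (int ?n \<cdot>\<^sub>m 1\<^sub>m ?n) $$ (j, k)"
    using H by (simp add: hadamard_mat_def)
  moreover have "(?H * transpose_mat ?H) $$ (j, k) = (\<Sum>i<?n. ?H $$ (j, i) * ?H $$ (k, i))"
    using c j k by (simp add: scalar_prod_def lessThan_atLeast0)
  moreover have "\<dots> = (\<Sum>i<?n. cyc X (i + j) * cyc X (i + k))"
    using j k by (intro sum.cong) (simp_all add: circulant_index add.commute)
  ultimately show ?thesis
    using j k by simp
qed

text \<open>
  Expanding the square leaves only the diagonal terms. The orthogonality of the rows suffices
  here, because the entry at \<open>(i, j)\<close> depends on \<open>i + j\<close> only and the matrix is symmetric.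
\<close>

lemma hadamard_circulant_energy:
  fixes w :: "nat \<Rightarrow> int"
  assumes H: "hadamard_mat (length X) (circulant X)"
  shows "(\<Sum>i<length X. (\<Sum>j<length X. w j * cyc X (i + j))\<^sup>2)
           = int (length X) * (\<Sum>j<length X. (w j)\<^sup>2)"
proof -
  let ?n = "length X"
  have "(\<Sum>i<?n. (\<Sum>j<?n. w j * cyc X (i + j))\<^sup>2)
      = (\<Sum>i<?n. \<Sum>j<?n. \<Sum>k<?n. w j * w k * (cyc X (i + j) * cyc X (i + k)))"
    by (simp add: power2_eq_square sum_product algebra_simps)
  also have "\<dots> = (\<Sum>j<?n. \<Sum>i<?n. \<Sum>k<?n. w j * w k * (cyc X (i + j) * cyc X (i + k)))"
    by (rule sum.swap)
  also have "\<dots> = (\<Sum>j<?n. \<Sum>k<?n. \<Sum>i<?n. w j * w k * (cyc X (i + j) * cyc X (i + k)))"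
    by (intro sum.cong refl sum.swap)
  also have "\<dots> = (\<Sum>j<?n. \<Sum>k<?n. w j * w k * (if j = k then int ?n else 0))"
    using hadamard_circulant_correlation[OF H]
    by (intro sum.cong refl) (simp flip: sum_distrib_left)
  also have "\<dots> = (\<Sum>j<?n. int ?n * (w j)\<^sup>2)"
    by (intro sum.cong refl) (simp add: if_distrib power2_eq_square algebra_simps cong: if_cong)
  finally show ?thesis
    by (simp add: sum_distrib_left)
qed

section \<open>The difference between the two halves\<close>

definition half_diff :: "nat \<Rightarrow> int list \<Rightarrow> nat \<Rightarrow> int" where
  "half_diff N X i = (\<Sum>j<N. cyc X (i + j)) - (\<Sum>j<N. cyc X (i + N + j))"

lemma half_diff_add_half:
  assumes "length X = 2 * N"
  shows "half_diff N X (i + N) = - half_diff N X i"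
proof -
  have "cyc X (i + N + N + j) = cyc X (i + j)" for j
    using cyc_add_two_halves[OF assms, of "i + j"] by (simp only: ac_simps)
  then show ?thesis
    by (simp add: half_diff_def)
qed

lemma half_diff_Suc:
  assumes "length X = 2 * N"
  shows "half_diff N X (Suc i) = half_diff N X i + 2 * (cyc X (i + N) - cyc X i)"
proof -
  have slide: "(\<Sum>j<N. cyc X (Suc k + j)) = (\<Sum>j<N. cyc X (k + j)) + cyc X (k + N) - cyc X k" for k
    using sum.lessThan_Suc[of "\<lambda>j. cyc X (k + j)" N]
      sum.lessThan_Suc_shift[of "\<lambda>j. cyc X (k + j)" N]
    by simp
  have "cyc X (i + N + N) = cyc X i"
    by (rule cyc_add_two_halves[OF assms])
  then show ?thesis
    using slide[of i] slide[of "i + N"] by (simp add: half_diff_def)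
qed

lemma half_diff_step:
  assumes len: "length X = 2 * N" and "N > 0" and pm: "set X \<subseteq> {1, -1}"
  shows "\<bar>half_diff N X (Suc i) - half_diff N X i\<bar> \<le> 4"
proof -
  have "cyc X k \<in> {1, -1}" for k
  proof -
    have "k mod length X < length X"
      using len \<open>N > 0\<close> by simp
    then show ?thesis
      using pm nth_mem unfolding cyc_def by blast
  qed
  from this[of i] this[of "i + N"] show ?thesis
    unfolding half_diff_Suc[OF len] by auto
qed

lemma sum_half_diff_squares:
  assumes len: "length X = 2 * N" and H: "hadamard_mat (2 * N) (circulant X)"
  shows "(\<Sum>i<2 * N. (half_diff N X i)\<^sup>2) = (2 * int N)\<^sup>2"
proof -
  define w :: "nat \<Rightarrow> int" where "w j = (if j < N then 1 else -1)" for j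
  have "sum f {..<N + M} = (\<Sum>j<N. f j) + (\<Sum>j<M. f (N + j))" for f :: "nat \<Rightarrow> int" and M
    by (induction M) (simp_all add: add.assoc)
  from this[of _ N]
  have split: "sum f {..<2 * N} = (\<Sum>j<N. f j) + (\<Sum>j<N. f (N + j))" for f :: "nat \<Rightarrow> int"
    by (simp only: mult_2)
  have "half_diff N X i = (\<Sum>j<2 * N. w j * cyc X (i + j))" for i
    unfolding split by (simp add: half_diff_def w_def sum_negf add.assoc)
  moreover have "(\<Sum>j<2 * N. (w j)\<^sup>2) = 2 * int N"
    unfolding split by (simp add: w_def)
  ultimately show ?thesis
    using hadamard_circulant_energy[of X w] H len by (simp add: power2_eq_square)
qed

text \<open>
  A value beyond \<open>N\<close> at position \<open>0\<close> is repeated, up to sign, at position \<open>N\<close>, and its four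
  cyclic neighbours at positions \<open>\<plusminus>1\<close> and \<open>N \<plusminus> 1\<close> are beyond \<open>N - 4\<close>. These six squares
  contribute more than \<open>2N\<^sup>2 + 4(N - 4)\<^sup>2\<close> to a total of \<open>4N\<^sup>2\<close>, which is impossible when
  \<open>N\<^sup>2 - 16N + 32 > 0\<close>. The bound \<open>14\<close> is the least integer above the larger root.
\<close>

lemma half_diff_bound:
  assumes len: "length X = 2 * N" and pm: "set X \<subseteq> {1, -1}"
    and H: "hadamard_mat (2 * N) (circulant X)" and N: "N \<ge> 14"
  shows "\<bar>half_diff N X 0\<bar> \<le> int N"
proof (rule ccontr)
  assume neg: "\<not> ?thesis"
  define d where "d = half_diff N X"
  have large: "\<bar>d 0\<bar> > int N"
    using neg by (simp add: d_def)
  have shift: "d (i + N) = - d i" for i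
    unfolding d_def by (rule half_diff_add_half[OF len])
  have step: "\<bar>d (Suc i) - d i\<bar> \<le> 4" for i
    unfolding d_def using half_diff_step[OF len _ pm] N by simp
  have dN: "d N = - d 0" "d (Suc N) = - d 1" "d (2 * N - 1) = - d (N - 1)"
    using shift[of 0] shift[of 1] shift[of "N - 1"] N by (simp_all add: mult_2)
  have sq: "(int N - 4)\<^sup>2 \<le> y\<^sup>2" if "int N - 4 \<le> \<bar>y\<bar>" for y :: int
    using power_mono[OF that, of 2] N by simp
  have d0: "(int N)\<^sup>2 \<le> (d 0)\<^sup>2"
    using power_mono[of "int N" "\<bar>d 0\<bar>" 2] large by simp
  have d1: "(int N - 4)\<^sup>2 \<le> (d 1)\<^sup>2"
    using step[of 0] large by (intro sq) simp
  have d_pred: "(int N - 4)\<^sup>2 \<le> (d (N - 1))\<^sup>2"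
    using step[of "N - 1"] dN(1) large N by (intro sq) simp
  have "2 * (int N)\<^sup>2 + 4 * (int N - 4)\<^sup>2
      \<le> (\<Sum>i\<leftarrow>[0, 1, N - 1, N, Suc N, 2 * N - 1]. (d i)\<^sup>2)"
    using d0 d1 d_pred by (simp add: dN del: One_nat_def)
  also have "\<dots> = (\<Sum>i\<in>set [0, 1, N - 1, N, Suc N, 2 * N - 1]. (d i)\<^sup>2)"
    using N by (intro sum.distinct_set_conv_list[symmetric]) auto
  also have "\<dots> \<le> (\<Sum>i<2 * N. (d i)\<^sup>2)"
    using N by (intro sum_mono2) auto
  also have "\<dots> = (2 * int N)\<^sup>2"
    unfolding d_def by (rule sum_half_diff_squares[OF len H])
  finally have "(int N - 2) * (int N - 14) + 4 \<le> 0"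
    by (simp add: power2_eq_square algebra_simps)
  moreover have "(int N - 2) * (int N - 14) \<ge> 0"
    using N by simp
  ultimately show False
    by linarith
qed

section \<open>Weights of the two halves\<close>

lemma sum_list_pm:
  assumes "set U \<subseteq> {1, -1}"
  shows "sum_list U = 2 * int (hamming_weight U) - int (length U)"
  using assms by (induction U) (auto simp: hamming_weight_def)

lemma half_diff_weights:
  assumes len: "length X = 2 * N" and pm: "set X \<subseteq> {1, -1}"
  shows "half_diff N X 0
           = 2 * (int (hamming_weight (take N X)) - int (hamming_weight (drop N X)))"
proof -
  have "(\<Sum>j<N. cyc X j) = sum_list (take N X)"
    using len by (simp add: sum_list_sum_nth cyc_def lessThan_atLeast0)
  moreover have "(\<Sum>j<N. cyc X (N + j)) = sum_list (drop N X)"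
    using len by (simp add: sum_list_sum_nth cyc_def lessThan_atLeast0)
  moreover have "set (take N X) \<subseteq> {1, -1}" "set (drop N X) \<subseteq> {1, -1}"
    using pm set_take_subset[of N X] set_drop_subset[of N X] by auto
  ultimately show ?thesis
    using len by (simp add: half_diff_def sum_list_pm)
qed

lemma hamming_weight_take_drop:
  "hamming_weight (take N X) + hamming_weight (drop N X) = hamming_weight X"
  unfolding hamming_weight_def by (metis append_take_drop_id count_list_append)

theorem theorem5:
  fixes m :: nat and X :: "int list"
  assumes "m \<ge> 1" and "odd m"
    and "X \<in> weight_class (4 * m\<^sup>2) (2 * m\<^sup>2 - m)"
    and "hadamard_mat (4 * m\<^sup>2) (circulant X)"
  shows "\<exists>a b :: nat.
           X \<in> concat_prod (weight_class (2 * m\<^sup>2) a) (weight_class (2 * m\<^sup>2) b) \<and>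
           ((real m)\<^sup>2 - real m) / 2 \<le> real a \<and>
           real a \<le> (3 * (real m)\<^sup>2 - real m) / 2 \<and>
           int b = 2 * (int m)\<^sup>2 - int m - int a"
proof -
  define N where "N = 2 * m\<^sup>2"
  define a where "a = hamming_weight (take N X)"
  define b where "b = hamming_weight (drop N X)"
  have len: "length X = 2 * N" and pm: "set X \<subseteq> {1, -1}"
    and weight: "hamming_weight X = 2 * m\<^sup>2 - m"
    using assms(3) by (auto simp: weight_class_def pm_seqs_def N_def)
  have H: "hadamard_mat (2 * N) (circulant X)"
    using assms(4) by (simp add: N_def)
  have "m \<le> 2 * m\<^sup>2"
    using self_le_power[of m 2] assms(1) by simp
  then have ab: "int a + int b = 2 * (int m)\<^sup>2 - int m"
    using hamming_weight_take_drop[of N X] weight by (simp add: a_def b_def flip: of_nat_add)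
  have diff: "\<bar>int a - int b\<bar> \<le> (int m)\<^sup>2"
  proof (cases "m = 1")
    case True
    with ab show ?thesis by simp
  next
    case False
    with assms(1,2) have "m \<ge> 3"
      by presburger
    then have "N \<ge> 14"
      using power_mono[of 3 m 2] by (simp add: N_def)
    from half_diff_bound[OF len pm H this] have "\<bar>2 * (int a - int b)\<bar> \<le> int N"
      by (simp only: half_diff_weights[OF len pm] a_def b_def)
    then show ?thesis
      unfolding N_def by simp
  qed
  have "X \<in> concat_prod (weight_class N a) (weight_class N b)"
  proof -
    have "take N X \<in> weight_class N a" "drop N X \<in> weight_class N b"
      using len pm set_take_subset[of N X] set_drop_subset[of N X]
      by (auto simp: weight_class_def pm_seqs_def a_def b_def)
    then show ?thesis
      unfolding concat_prod_def using append_take_drop_id[of N X, symmetric] by blast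
  qed
  moreover have "(int m)\<^sup>2 - int m \<le> 2 * int a" "2 * int a \<le> 3 * (int m)\<^sup>2 - int m"
    using ab diff by linarith+
  then have "(real m)\<^sup>2 - real m \<le> 2 * real a" "2 * real a \<le> 3 * (real m)\<^sup>2 - real m"
    by (simp_all flip: of_int_le_iff[where 'a = real])
  moreover have "int b = 2 * (int m)\<^sup>2 - int m - int a"
    using ab by simp
  ultimately show ?thesis
    unfolding N_def by (intro exI[of _ a] exI[of _ b]) simp
qed

end
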